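(* Let $\mathcal{F}$ be a family of $2$-element subsets of a finite set $[n]$, and let $G=K(\mathcal{F})$. Then $\overline{\xi}_l(G,\mathbb{R})=\chi(G)$. Equivalently, for every graph $G$ that is the complement of a line graph, $\overline{\xi}_l(G,\mathbb{R})=\chi(G)$.
   Context: For a set system $\mathcal{F}$, $K(\mathcal{F})$ is the graph with vertex set $\mathcal{F}$ in which distinct $A,B\in\mathcal{F}$ are adjacent iff $A\cap B=\emptyset$. For a vertex $v$, $N(v)$ is its set of neighbors. For $x,y\in\mathbb{R}^t$, $\langle x,y\rangle=\sum_i x_iy_i$. An orthogonal representation of $G=(V,E)$ over a field $\mathbb{F}$ assigns $u_v\in\mathbb{F}^t$ to every $v\in V$ with $\langle u_v,u_v\rangle\neq0$ and $\langle u_v,u_{v'}\rangle=0$ for adjacent $v,v'$. Its locality is $\max_{v}\dim\mathrm{span}\{u_{v'}: v'\in\{v\}\cup N(v)\}$, and $\overline{\xi}_l(G,\mathbb{F})$ is the minimum locality of an orthogonal representation of $G$ over $\mathbb{F}$. $\chi(G)$ is the chromatic number. *)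

theory Defs
  imports Complex_Main "HOL-Library.Function_Algebras"
begin

definition K_adj :: "'a set set \<Rightarrow> 'a set \<Rightarrow> 'a set \<Rightarrow> bool" where
  "K_adj F A B \<longleftrightarrow> A \<in> F \<and> B \<in> F \<and> A \<noteq> B \<and> A \<inter> B = {}"

text \<open>Vectors of R^t are represented as functions nat => real vanishing outside {..<t}.\<close>
definition rscale :: "real \<Rightarrow> (nat \<Rightarrow> real) \<Rightarrow> (nat \<Rightarrow> real)" where
  "rscale c f = (\<lambda>i. c * f i)"

lemma vector_space_rscale: "vector_space rscale"
  by unfold_locales (auto simp: rscale_def algebra_simps)

definition vdim :: "(nat \<Rightarrow> real) set \<Rightarrow> nat" where
  "vdim S = vector_space.dim rscale S"

definition ip :: "nat \<Rightarrow> (nat \<Rightarrow> real) \<Rightarrow> (nat \<Rightarrow> real) \<Rightarrow> real" where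
  "ip t x y = (\<Sum>i<t. x i * y i)"

definition nbhd :: "'v set \<Rightarrow> ('v \<Rightarrow> 'v \<Rightarrow> bool) \<Rightarrow> 'v \<Rightarrow> 'v set" where
  "nbhd V E v = {w \<in> V. E v w}"

definition orth_rep :: "'v set \<Rightarrow> ('v \<Rightarrow> 'v \<Rightarrow> bool) \<Rightarrow> nat \<Rightarrow> ('v \<Rightarrow> nat \<Rightarrow> real) \<Rightarrow> bool" where
  "orth_rep V E t u \<longleftrightarrow>
     (\<forall>v\<in>V. (\<forall>i\<ge>t. u v i = 0) \<and> ip t (u v) (u v) \<noteq> 0) \<and>
     (\<forall>v\<in>V. \<forall>w\<in>V. E v w \<longrightarrow> ip t (u v) (u w) = 0)"

text \<open>Locality (maximum over an empty vertex set taken to be 0).\<close>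
definition locality :: "'v set \<Rightarrow> ('v \<Rightarrow> 'v \<Rightarrow> bool) \<Rightarrow> ('v \<Rightarrow> nat \<Rightarrow> real) \<Rightarrow> nat" where
  "locality V E u = Max (insert 0 ((\<lambda>v. vdim (u ` ({v} \<union> nbhd V E v))) ` V))"

definition xi_l_real :: "'v set \<Rightarrow> ('v \<Rightarrow> 'v \<Rightarrow> bool) \<Rightarrow> nat" where
  "xi_l_real V E = (LEAST k. \<exists>t u. orth_rep V E t u \<and> locality V E u = k)"

definition chromatic_number :: "'v set \<Rightarrow> ('v \<Rightarrow> 'v \<Rightarrow> bool) \<Rightarrow> nat" where
  "chromatic_number V E = (LEAST k. \<exists>c :: 'v \<Rightarrow> nat. (\<forall>v\<in>V. c v < k) \<and>
      (\<forall>v\<in>V. \<forall>w\<in>V. E v w \<longrightarrow> c v \<noteq> c w))"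

end

theory Submission
  imports Defs
begin

text \<open>
  Colour classes of \<open>K_adj F\<close> are intersecting families, so colouring by unit vectors bounds the
  local dimension by the chromatic number. For the converse, take a graph \<open>F\<close> with as few edges as
  possible that has a representation of locality \<open>k\<close> but no \<open>k\<close>-colouring, and write \<open>d\<close> for the
  dimension spanned by the vectors of a set of edges. As deleting an intersecting family saves at
  most one colour, each edge \<open>{x, y}\<close> is non-orthogonal to edges \<open>{x, z}\<close> and \<open>{y, w}\<close> with \<open>z \<noteq> w\<close>,
  and \<open>d (F - T) > k - |T|\<close> for every set \<open>T\<close> of vertices that meets an edge. Call \<open>T\<close> tight if
  \<open>d (F - T) = k + 1 - |T|\<close>; every edge is a tight set. A tight set that is not a vertex cover stays
  tight after adding a suitable vertex, since otherwise the edges meeting \<open>T\<close> and those avoiding it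
  are mutually orthogonal and can be coloured separately. Going back from vertex covers, \<open>F - T\<close> is
  a matching for every tight \<open>T\<close>. Applied to the edges of \<open>F\<close>, this shows that \<open>F\<close> consists
  of edges on four vertices, for which two colours suffice, and \<open>k - 2\<close> further edges.
\<close>

section \<open>Dimension and orthogonality\<close>

context vector_space
begin

lemma dim_insert_finite:
  assumes "finite S"
  shows "dim (insert x S) = (if x \<in> span S then dim S else dim S + 1)"
proof (cases "x \<in> span S")
  case True
  then show ?thesis by (metis dim_span span_redundant)
next
  case False
  obtain B where B: "B \<subseteq> S" "independent B" "S \<subseteq> span B" "card B = dim S"
    by (rule basis_exists)
  have "finite B" using B(1) assms by (rule finite_subset)
  moreover have "x \<notin> span B" using False span_mono[OF B(1)] by blast
  moreover from this have "x \<notin> B" using span_base[of x B] by blast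
  moreover have "insert x S \<subseteq> span (insert x B)"
    using B(3) span_mono[of B "insert x B"] span_base[of x "insert x B"] by blast
  moreover have "independent (insert x B)"
    using \<open>x \<notin> span B\<close> B(2) by (rule independent_insertI)
  ultimately have "dim (insert x S) = Suc (card B)"
    using B(1) by (intro dim_unique[of "insert x B"]) auto
  then show ?thesis using False B by simp
qed

text \<open>Finiteness of \<open>W\<close> matters: the ambient space is infinite-dimensional, and
  \<open>dim\<close> is 0 for sets that span an infinite-dimensional subspace.\<close>

lemma dim_mono_finite:
  assumes "finite W" "V \<subseteq> span W"
  shows "dim V \<le> dim W"
proof -
  obtain B where B: "B \<subseteq> W" "independent B" "W \<subseteq> span B" "card B = dim W"
    by (rule basis_exists)
  then have "V \<subseteq> span B"
    using assms(2) span_minimal[OF B(3) subspace_span] by blast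
  then show ?thesis
    using dim_le_card[of V B] B finite_subset[OF B(1) assms(1)] by simp
qed

lemma subset_span_if_dim_le:
  assumes "finite X" "Y \<subseteq> X" "dim X \<le> dim Y"
  shows "X \<subseteq> span Y"
proof (rule ccontr)
  assume "\<not> X \<subseteq> span Y"
  then obtain x where "x \<in> X" "x \<notin> span Y" by blast
  moreover have "finite Y" using assms finite_subset by blast
  ultimately have "dim (insert x Y) = dim Y + 1"
    by (simp add: dim_insert_finite)
  moreover have "dim (insert x Y) \<le> dim X"
    using \<open>x \<in> X\<close> assms span_superset[of X] by (intro dim_mono_finite) auto
  ultimately show False using assms by simp
qed

text \<open>When \<open>y\<close> is added to \<open>Y\<close>, both sides grow in the same cases:
  if \<open>y = a + b\<close> with \<open>a\<close> in the span of \<open>X\<close> and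
  \<open>b\<close> in that of \<open>Y\<close>, then \<open>a = y - b\<close> lies in both spans and
  is zero.\<close>

lemma dim_Un_if_spans_disjoint:
  assumes "finite X" "finite Y" "span X \<inter> span Y \<subseteq> {0}"
  shows "dim (X \<union> Y) = dim X + dim Y"
  using assms(2,3)
proof (induction Y rule: finite_induct)
  case empty
  show ?case using dim_eq_card_independent[OF independent_empty] by simp
next
  case (insert y Y)
  have "span Y \<subseteq> span (insert y Y)" by (rule span_mono) blast
  then have IH: "dim (X \<union> Y) = dim X + dim Y"
    using insert by blast
  have "y \<in> span Y" if "y \<in> span (X \<union> Y)"
  proof -
    from that obtain a b where ab: "y = a + b" "a \<in> span X" "b \<in> span Y"
      unfolding span_Un by blast
    have "a = y - b" using ab by simp
    moreover have "y - b \<in> span (insert y Y)"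
      using ab(3) \<open>span Y \<subseteq> _\<close> by (intro span_diff) (auto intro: span_base)
    ultimately have "a = 0" using insert.prems ab by blast
    then show ?thesis using ab by simp
  qed
  then have "y \<in> span (X \<union> Y) \<longleftrightarrow> y \<in> span Y"
    using span_mono[of Y "X \<union> Y"] by blast
  then show ?case
    using IH insert.hyps assms(1) by (simp add: dim_insert_finite)
qed

end

interpretation rvec: vector_space rscale
  by (rule vector_space_rscale)

lemma ip_commute: "ip t x y = ip t y x"
  by (simp add: ip_def mult.commute)

lemma ip_span_eq_0:
  assumes "\<And>y. y \<in> S \<Longrightarrow> ip t x y = 0" "y \<in> rvec.span S"
  shows "ip t x y = 0"
  using assms(2)
proof (induction rule: rvec.span_induct_alt)
  case base
  show ?case by (simp add: ip_def)
next
  case (step c a b)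
  have eq: "ip t x (rscale c a + b) = c * ip t x a + ip t x b"
    by (simp add: ip_def rscale_def sum.distrib sum_distrib_left algebra_simps)
  show ?case unfolding eq using step assms(1) by simp
qed

lemma span_vanishes:
  assumes "\<And>x. x \<in> S \<Longrightarrow> x i = 0" "y \<in> rvec.span S"
  shows "y i = (0::real)"
  using assms(2)
proof (induction rule: rvec.span_induct_alt)
  case (step c a b)
  then show ?case using assms(1)[of a] by (simp add: rscale_def)
qed simp

text \<open>A common vector is orthogonal to \<open>X\<close>, hence to itself, so its first
  \<open>t\<close> coordinates vanish. The others are invisible to \<open>ip t\<close> and vanish
  because they do so on \<open>X\<close>.\<close>

lemma orthogonal_spans_disjoint:
  assumes "\<And>x i. x \<in> X \<Longrightarrow> i \<ge> t \<Longrightarrow> x i = 0"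
    and "\<And>x y. x \<in> X \<Longrightarrow> y \<in> Y \<Longrightarrow> ip t x y = 0"
  shows "rvec.span X \<inter> rvec.span Y \<subseteq> {0}"
proof
  fix v assume v: "v \<in> rvec.span X \<inter> rvec.span Y"
  have "ip t x v = 0" if "x \<in> X" for x
    using ip_span_eq_0[of Y t x v] assms(2) that v by blast
  then have "ip t v v = 0"
    using ip_span_eq_0[of X t v v] v by (simp add: ip_commute)
  then have "v i = 0" if "i < t" for i
    using that unfolding ip_def by (subst (asm) sum_nonneg_eq_0_iff) auto
  moreover have "v i = 0" if "i \<ge> t" for i
    using span_vanishes[of X i v] assms(1) that v by blast
  ultimately show "v \<in> {0}"
    by (metis fun_eq_iff linorder_not_less singletonI zero_fun_apply)
qed

section \<open>Colourings by intersecting families\<close>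

definition colourable :: "'a set set \<Rightarrow> nat \<Rightarrow> bool" where
  "colourable F k \<longleftrightarrow> (\<exists>c :: 'a set \<Rightarrow> nat. (\<forall>e\<in>F. c e < k) \<and>
     (\<forall>e\<in>F. \<forall>f\<in>F. e \<inter> f = {} \<longrightarrow> e \<noteq> f \<longrightarrow> c e \<noteq> c f))"

lemma colourable_mono:
  assumes "colourable F k" "k \<le> l"
  shows "colourable F l"
proof -
  obtain c where "\<forall>e\<in>F. c e < k" "\<forall>e\<in>F. \<forall>f\<in>F. e \<inter> f = {} \<longrightarrow> e \<noteq> f \<longrightarrow> c e \<noteq> c f"
    using assms(1) unfolding colourable_def by blast
  moreover from this have "\<forall>e\<in>F. c e < l" using assms(2) by fastforce
  ultimately show ?thesis unfolding colourable_def by blast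
qed

lemma colourable_empty: "colourable {} k"
  by (simp add: colourable_def)

lemma colourable_intersecting:
  assumes "\<And>e f. e \<in> F \<Longrightarrow> f \<in> F \<Longrightarrow> e \<noteq> f \<Longrightarrow> e \<inter> f \<noteq> {}"
  shows "colourable F 1"
  unfolding colourable_def using assms by (intro exI[of _ "\<lambda>_. 0"]) auto

lemma colourable_Un:
  assumes "colourable F k" "colourable G l" "H \<subseteq> F \<union> G"
  shows "colourable H (k + l)"
proof -
  obtain c where c: "\<forall>e\<in>F. c e < k" "\<forall>e\<in>F. \<forall>f\<in>F. e \<inter> f = {} \<longrightarrow> e \<noteq> f \<longrightarrow> c e \<noteq> c f"
    using assms(1) unfolding colourable_def by blast
  obtain c' where c': "\<forall>e\<in>G. c' e < l" "\<forall>e\<in>G. \<forall>f\<in>G. e \<inter> f = {} \<longrightarrow> e \<noteq> f \<longrightarrow> c' e \<noteq> c' f"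
    using assms(2) unfolding colourable_def by blast
  define g where "g e = (if e \<in> F then c e else k + c' e)" for e
  have "g e < k + l" if "e \<in> H" for e
    using that c(1) c'(1) assms(3) unfolding g_def by (auto simp: trans_less_add1)
  moreover have "g e \<noteq> g f" if "e \<in> H" "f \<in> H" "e \<inter> f = {}" "e \<noteq> f" for e f
  proof -
    have "e \<in> F \<or> e \<in> G" "f \<in> F \<or> f \<in> G"
      using that assms(3) by auto
    moreover have "c e < k" if "e \<in> F" for e using c(1) that by simp
    ultimately show ?thesis
      using that c(2) c'(2) unfolding g_def
      by (smt (verit) add_left_cancel not_add_less1)
  qed
  ultimately show ?thesis unfolding colourable_def by blast
qed

definition avoiding :: "'a set set \<Rightarrow> 'a set \<Rightarrow> 'a set set" where
  "avoiding F T = {e \<in> F. e \<inter> T = {}}"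

lemma in_avoiding: "e \<in> avoiding F T \<longleftrightarrow> e \<in> F \<and> e \<inter> T = {}"
  by (simp add: avoiding_def)

lemma avoiding_subset: "avoiding F T \<subseteq> F"
  by (simp add: avoiding_def)

text \<open>The edges through one vertex form a star, which is intersecting, so each vertex of
  \<open>T\<close> costs one colour.\<close>

lemma colourable_if_avoiding:
  assumes "finite T" "colourable (avoiding F T) k"
  shows "colourable F (k + card T)"
  using assms
proof (induction T arbitrary: k rule: finite_induct)
  case empty
  then show ?case by (simp add: avoiding_def)
next
  case (insert x T)
  have star: "colourable {e \<in> F. x \<in> e} 1"
    by (rule colourable_intersecting) blast
  have "colourable (avoiding F T) (k + 1)"
    by (rule colourable_Un[OF insert.prems star]) (auto simp: avoiding_def)
  then show ?case using insert.IH insert.hyps by fastforce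
qed

section \<open>A minimal counterexample\<close>

text \<open>The properties of the dimension \<open>d\<close> of the span of a set of vectors, indexed by the edges of a
  graph, that the combinatorial argument needs.\<close>

locale orth_rank =
  fixes F :: "'a set set" and d :: "'a set set \<Rightarrow> nat" and orth :: "'a set \<Rightarrow> 'a set \<Rightarrow> bool"
  assumes finite_F: "finite F"
    and card_edge: "e \<in> F \<Longrightarrow> card e = 2"
    and d_mono: "X \<subseteq> Y \<Longrightarrow> Y \<subseteq> F \<Longrightarrow> d X \<le> d Y"
    and d_le_card: "X \<subseteq> F \<Longrightarrow> d X \<le> card X"
    and d_closure: "Z \<subseteq> X \<Longrightarrow> X \<subseteq> F \<Longrightarrow> Z \<subseteq> Y \<Longrightarrow> Y \<subseteq> F \<Longrightarrow> d X \<le> d Z \<Longrightarrow> d Y \<le> d Z \<Longrightarrow> d (X \<union> Y) \<le> d Z"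
    and d_orth: "X \<subseteq> F \<Longrightarrow> Y \<subseteq> F \<Longrightarrow> (\<And>x y. x \<in> X \<Longrightarrow> y \<in> Y \<Longrightarrow> orth x y) \<Longrightarrow> d X + d Y \<le> d (X \<union> Y)"
    and d_less: "Y \<subseteq> X \<Longrightarrow> X \<subseteq> F \<Longrightarrow> x \<in> X \<Longrightarrow> e \<in> F \<Longrightarrow> \<not> orth e x \<Longrightarrow> (\<And>y. y \<in> Y \<Longrightarrow> orth e y) \<Longrightarrow> d Y < d X"
    and orth_commute: "e \<in> F \<Longrightarrow> f \<in> F \<Longrightarrow> orth e f \<longleftrightarrow> orth f e"
    and not_orth_self: "e \<in> F \<Longrightarrow> \<not> orth e e"
    and orth_disjoint: "e \<in> F \<Longrightarrow> f \<in> F \<Longrightarrow> e \<inter> f = {} \<Longrightarrow> orth e f"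
begin

lemma d_pos: "e \<in> X \<Longrightarrow> X \<subseteq> F \<Longrightarrow> 0 < d X"
  using d_less[of "{}" X e e] not_orth_self[of e] by auto

lemma d_empty: "d {} = 0"
  using d_le_card[of "{}"] by simp

lemma d_insert_orth:
  assumes "e \<in> F" "X \<subseteq> F" "\<And>x. x \<in> X \<Longrightarrow> orth e x"
  shows "d X + 1 \<le> d (insert e X)"
  using d_orth[of "{e}" X] d_pos[of e "{e}"] assms by simp

lemma edge_other: "e \<in> F \<Longrightarrow> x \<in> e \<Longrightarrow> \<exists>y. e = {x, y} \<and> x \<noteq> y"
  using card_edge[of e] unfolding card_2_iff by blast

lemma edge_nonempty: "e \<in> F \<Longrightarrow> e \<noteq> {}"
  using card_edge[of e] by auto

lemma edge_distinct: "{x, y} \<in> F \<Longrightarrow> x \<noteq> y"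
  using card_edge[of "{x, y}"] by auto

lemma not_orth_meet: "e \<in> F \<Longrightarrow> f \<in> F \<Longrightarrow> \<not> orth e f \<Longrightarrow> e \<inter> f \<noteq> {}"
  using orth_disjoint by blast

lemma d_matching:
  assumes "M \<subseteq> F" "\<And>e f. e \<in> M \<Longrightarrow> f \<in> M \<Longrightarrow> e \<noteq> f \<Longrightarrow> e \<inter> f = {}"
  shows "d M = card M"
proof -
  have "finite M" using assms(1) finite_F finite_subset by blast
  then have "card M \<le> d M"
    using assms
  proof (induction M rule: finite_induct)
    case (insert e M)
    have "card M \<le> d M" using insert.prems by (intro insert.IH) auto
    moreover have "d M + 1 \<le> d (insert e M)"
      using insert.prems insert.hyps(2) by (intro d_insert_orth orth_disjoint) auto
    ultimately show ?case using insert.hyps by simp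
  qed simp
  then show ?thesis using d_le_card assms(1) by (simp add: le_antisym)
qed

end

text \<open>An edge adds one dimension to its neighbours in the disjointness graph, so
  \<open>local_dim\<close> says that the locality is at most \<open>k\<close>. In
  \<open>minimal\<close> the bound \<open>l\<close> is free, since subfamilies are coloured with
  other numbers of colours than \<open>k\<close>.\<close>

locale minimal_counterexample = orth_rank +
  fixes k :: nat
  assumes local_dim: "e \<in> F \<Longrightarrow> d (avoiding F e) < k"
    and not_colourable: "\<not> colourable F k"
    and minimal: "G \<subset> F \<Longrightarrow> (\<And>e. e \<in> G \<Longrightarrow> d (avoiding G e) < l) \<Longrightarrow> colourable G l"
begin

section \<open>Dimension bounds from minimality\<close>

lemma colourable_d:
  assumes "G \<subset> F"
  shows "colourable G (d G)"
proof (rule minimal[OF assms])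
  fix e assume e: "e \<in> G"
  have "insert e (avoiding G e) \<subseteq> G" using e by (auto simp: avoiding_def)
  moreover have "d (avoiding G e) + 1 \<le> d (insert e (avoiding G e))"
    using e assms by (intro d_insert_orth orth_disjoint) (auto simp: avoiding_def)
  ultimately show "d (avoiding G e) < d G"
    using d_mono[of "insert e (avoiding G e)" G] assms by fastforce
qed

text \<open>Otherwise the stars at \<open>T\<close>, together with \<open>d (avoiding F T)\<close>
  colours for the remaining proper subfamily, would colour \<open>F\<close> with \<open>k\<close>
  colours.\<close>

lemma d_avoiding_lower:
  assumes "finite T" "e \<in> F" "e \<inter> T \<noteq> {}"
  shows "k < d (avoiding F T) + card T"
proof (rule ccontr)
  assume "\<not> ?thesis"
  moreover have "avoiding F T \<subset> F" using assms by (auto simp: avoiding_def)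
  ultimately show False
    using colourable_if_avoiding[OF assms(1) colourable_d] colourable_mono not_colourable
    by (metis linorder_not_less)
qed

lemma nonempty: "F \<noteq> {}"
  using not_colourable colourable_empty by auto

lemma k_pos: "0 < k"
  using nonempty local_dim by fastforce

text \<open>One colour suffices for \<open>X\<close>, so \<open>F - X\<close> is not colourable with
  \<open>k - 1\<close> colours. By minimality it violates the local bound for \<open>k - 1\<close>
  at some edge \<open>f\<close>.\<close>

lemma intersecting_critical:
  assumes "X \<subseteq> F" "X \<noteq> {}" "\<And>e f. e \<in> X \<Longrightarrow> f \<in> X \<Longrightarrow> e \<noteq> f \<Longrightarrow> e \<inter> f \<noteq> {}"
  obtains f where "f \<in> F - X" "k \<le> d (avoiding (F - X) f) + 1"
proof -
  have "\<not> colourable (F - X) (k - 1)"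
  proof
    assume "colourable (F - X) (k - 1)"
    then have "colourable F (k - 1 + 1)"
      by (rule colourable_Un[OF _ colourable_intersecting[OF assms(3)]]) auto
    then show False using not_colourable k_pos by simp
  qed
  moreover have "F - X \<subset> F" using assms by blast
  ultimately have "\<exists>f\<in>F - X. \<not> d (avoiding (F - X) f) < k - 1"
    using minimal[of "F - X" "k - 1"] by blast
  then show ?thesis using that k_pos by force
qed

lemma d_diff_intersecting:
  assumes "X \<subseteq> F" "X \<noteq> {}" "\<And>e f. e \<in> X \<Longrightarrow> f \<in> X \<Longrightarrow> e \<noteq> f \<Longrightarrow> e \<inter> f \<noteq> {}"
  shows "k \<le> d (F - X)"
proof -
  obtain f where f: "f \<in> F - X" "k \<le> d (avoiding (F - X) f) + 1"
    using intersecting_critical[OF assms] by blast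
  have "d (avoiding (F - X) f) + 1 \<le> d (insert f (avoiding (F - X) f))"
    using f by (intro d_insert_orth orth_disjoint) (auto simp: avoiding_def)
  also have "\<dots> \<le> d (F - X)"
    using f by (intro d_mono) (auto simp: avoiding_def)
  finally show ?thesis using f by simp
qed

text \<open>If the bound fails, the vectors of the edges avoiding the path already span those of all edges
  outside an intersecting family: the triangle on \<open>x\<close>, \<open>y\<close>, \<open>w\<close>, or the star of \<open>y\<close> if
  \<open>{x, w}\<close> is not an edge.\<close>

lemma d_avoiding_path:
  assumes "{x, y} \<in> F" "{y, w} \<in> F" "x \<noteq> w"
  shows "d (avoiding F {x, y, w}) + 2 \<le> k"
proof (rule ccontr)
  let ?Z = "avoiding F {x, y, w}"
  let ?A = "avoiding F {x, y}" and ?B = "avoiding F {y, w}"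
  let ?C = "if {x, w} \<in> F then avoiding F {x, w} else ?B"
  assume "\<not> ?thesis"
  then have Z: "k \<le> d ?Z + 1" by simp
  have sub: "?Z \<subseteq> ?A" "?Z \<subseteq> ?B" "?Z \<subseteq> ?C"
    by (auto simp: avoiding_def)
  have subF: "?A \<subseteq> F" "?B \<subseteq> F" "?C \<subseteq> F"
    by (auto simp: avoiding_def)
  \<comment> \<open>The local bound gives each of these sets dimension at most \<open>k - 1\<close>,
    which \<open>?Z\<close> already attains; being supersets of \<open>?Z\<close>, they all have the
    same span.\<close>
  have le: "d ?A \<le> d ?Z" "d ?B \<le> d ?Z" "d ?C \<le> d ?Z"
    using local_dim[of "{x, y}"] local_dim[of "{y, w}"] local_dim[of "{x, w}"] assms Z
    by (auto split: if_splits)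
  have "d (?A \<union> ?B) \<le> d ?Z"
    using sub subF le by (intro d_closure) auto
  then have "d (?A \<union> ?B \<union> ?C) \<le> d ?Z"
    using sub subF le by (intro d_closure) auto
  define X where "X = F - (?A \<union> ?B \<union> ?C)"
  have "F - X = ?A \<union> ?B \<union> ?C" using subF X_def by blast
  have xy: "x \<noteq> y" "y \<noteq> w" using assms edge_distinct by auto
  have "e \<inter> f \<noteq> {}" if "e \<in> X" "f \<in> X" "e \<noteq> f" for e f
  proof -
    have "card e = 2" "card f = 2" using that card_edge unfolding X_def by auto
    then obtain p q r s where "e = {p, q}" "p \<noteq> q" "f = {r, s}" "r \<noteq> s"
      by (meson card_2_iff)
    then show ?thesis
      using that xy assms(3) unfolding X_def avoiding_def
      by (auto simp: insert_commute split: if_splits)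
  qed
  moreover have "{x, y} \<in> X" using assms X_def by (auto simp: avoiding_def)
  ultimately have "k \<le> d (F - X)"
    by (intro d_diff_intersecting) (auto simp: X_def)
  then have "k \<le> d ?Z" using \<open>F - X = _\<close> \<open>d (?A \<union> ?B \<union> ?C) \<le> d ?Z\<close> by simp
  moreover have "d ?Z \<le> d ?A" using sub subF by (intro d_mono) auto
  ultimately show False using local_dim[OF assms(1)] by simp
qed

section \<open>Non-orthogonal neighbours of an edge\<close>

lemma not_orth_neighbour:
  assumes "{x, y} \<in> F"
  obtains z where "z \<noteq> y" "{x, z} \<in> F" "\<not> orth {x, y} {x, z}"
proof (rule ccontr)
  note obt = that
  assume "\<not> thesis"
  then have asm: "orth {x, y} {x, z}" if "z \<noteq> y" "{x, z} \<in> F" for z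
    using that obt by blast
  \<comment> \<open>Under the assumption, deleting the star of \<open>y\<close> leaves only edges
    orthogonal to \<open>{x, y}\<close>.\<close>
  define X where "X = {e \<in> F. y \<in> e}"
  obtain f where f: "f \<in> F - X" "k \<le> d (avoiding (F - X) f) + 1"
    using intersecting_critical[of X] assms unfolding X_def by blast
  have orth: "orth {x, y} g" if g: "g \<in> F - X" for g
  proof (cases "x \<in> g")
    case True
    then obtain z where "g = {x, z}" using edge_other[of g x] g by blast
    then show ?thesis using asm that X_def by auto
  next
    case False
    then show ?thesis using that assms X_def by (intro orth_disjoint) auto
  qed
  show False
  proof (cases "x \<in> f")
    case True
    then obtain w where w: "f = {x, w}" "x \<noteq> w" using edge_other[of f x] f by blast
    then have "w \<noteq> y" using f X_def by auto
    moreover have "avoiding (F - X) f = avoiding F {y, x, w}"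
      using w X_def by (auto simp: avoiding_def)
    ultimately show False
      using d_avoiding_path[of y x w] assms f w by (simp add: insert_commute)
  next
    case False
    \<comment> \<open>Here \<open>f\<close> misses \<open>x\<close> and \<open>y\<close>, so
      \<open>{x, y}\<close> can be put back and raises the dimension beyond the local bound at
      \<open>f\<close>.\<close>
    have "d (avoiding (F - X) f) + 1 \<le> d (insert {x, y} (avoiding (F - X) f))"
      using assms orth by (intro d_insert_orth) (auto simp: avoiding_def)
    also have "\<dots> \<le> d (avoiding F f)"
      using assms False f by (intro d_mono) (auto simp: avoiding_def X_def)
    finally show False using local_dim[of f] f by simp
  qed
qed

text \<open>If distinct end vertices cannot be chosen, the non-orthogonal neighbours at
  \<open>x\<close> and at \<open>y\<close> all end in one vertex \<open>z\<close>. Deleting the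
  triangle on \<open>x\<close>, \<open>y\<close>, \<open>z\<close> then leaves only edges orthogonal
  to \<open>{x, y}\<close>, which contradicts criticality.\<close>

lemma not_orth_path:
  assumes "{x, y} \<in> F"
  obtains z w where "z \<noteq> w" "z \<noteq> y" "w \<noteq> x" "{x, z} \<in> F" "{y, w} \<in> F"
    "\<not> orth {x, y} {x, z}" "\<not> orth {x, y} {y, w}"
proof (rule ccontr)
  note obt = that
  assume "\<not> thesis"
  then have asm: "z = w" if "z \<noteq> y" "w \<noteq> x" "{x, z} \<in> F" "{y, w} \<in> F"
    "\<not> orth {x, y} {x, z}" "\<not> orth {x, y} {y, w}" for z w
    using that obt by blast
  obtain z where z: "z \<noteq> y" "{x, z} \<in> F" "\<not> orth {x, y} {x, z}"
    using not_orth_neighbour[OF assms] by blast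
  obtain w where w: "w \<noteq> x" "{y, w} \<in> F" "\<not> orth {x, y} {y, w}"
    using not_orth_neighbour[of y x] assms by (auto simp: insert_commute)
  have "w = z" using asm z w by blast
  have xyz: "x \<noteq> y" "x \<noteq> z" "y \<noteq> z" using assms z w edge_distinct by auto
  define X where "X = {{x, y}, {x, z}, {y, z}}"
  have XF: "X \<subseteq> F" using assms z w \<open>w = z\<close> X_def by auto
  obtain f where f: "f \<in> F - X" "k \<le> d (avoiding (F - X) f) + 1"
    using intersecting_critical[of X] XF unfolding X_def by blast
  have orth: "orth {x, y} g" if g: "g \<in> F - X" for g
  proof (rule ccontr)
    assume n: "\<not> orth {x, y} g"
    then consider "x \<in> g" | "y \<in> g" using not_orth_meet[OF assms, of g] g by auto
    then show False
    proof cases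
      case 1
      then obtain a where "g = {x, a}" using edge_other[of g x] g by blast
      then show False using asm[of a z] n that w \<open>w = z\<close> X_def by auto
    next
      case 2
      then obtain a where "g = {y, a}" using edge_other[of g y] g by blast
      then show False using asm[of z a] n that z X_def by (auto simp: insert_commute)
    qed
  qed
  \<comment> \<open>As \<open>f\<close> lies outside the triangle, it contains at most one of its
    vertices, so some triangle edge that is not orthogonal to \<open>{x, y}\<close> avoids
    \<open>f\<close>. Putting it back raises the dimension.\<close>
  have "\<exists>g \<in> insert {x, y} X. \<not> orth {x, y} g \<and> g \<in> avoiding F f"
  proof -
    have fF: "f \<in> F" "f \<noteq> {x, y}" "f \<noteq> {x, z}" "f \<noteq> {y, z}" using f X_def by auto
    consider "x \<in> f" | "y \<in> f" | "x \<notin> f" "y \<notin> f" by blast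
    then show ?thesis
    proof cases
      case 1
      then obtain a where "f = {x, a}" using edge_other[of f x] fF by blast
      then have "{y, z} \<in> avoiding F f" using fF w \<open>w = z\<close> xyz by (auto simp: avoiding_def)
      then show ?thesis using w \<open>w = z\<close> X_def by blast
    next
      case 2
      then obtain a where "f = {y, a}" using edge_other[of f y] fF by blast
      then have "{x, z} \<in> avoiding F f" using fF z xyz by (auto simp: avoiding_def insert_commute)
      then show ?thesis using z X_def by blast
    next
      case 3
      then show ?thesis using assms not_orth_self by (auto simp: avoiding_def)
    qed
  qed
  then obtain g where g: "\<not> orth {x, y} g" "g \<in> avoiding F f" by blast
  have "d (avoiding (F - X) f) < d (avoiding F f)"
    by (rule d_less[of _ _ g "{x, y}"]) (use g assms orth in \<open>auto simp: avoiding_def\<close>)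
  then show False using local_dim[of f] f by simp
qed

text \<open>The vectors of \<open>{v, p}\<close> and \<open>{v, q}\<close> are parallel, so they are
  non-orthogonal to the same edges. A non-orthogonal neighbour of \<open>{v, p}\<close> at
  \<open>p\<close> must therefore meet \<open>{v, q}\<close>, and can do so only in
  \<open>q\<close>.\<close>

lemma parallel_edges_adjacent:
  assumes "G \<subseteq> F" "d G \<le> 1" "{v, p} \<in> G" "{v, q} \<in> G" "p \<noteq> q"
  shows "{p, q} \<in> F"
proof -
  have F: "{v, p} \<in> F" "{v, q} \<in> F" using assms by auto
  have par: "\<not> orth g {v, q}" if "g \<in> F" "\<not> orth g {v, p}" for g
  proof
    assume o: "orth g {v, q}"
    have "d {{v, q}} < d G"
      by (rule d_less[of _ _ "{v, p}" g]) (use assms that o in auto)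
    then show False using d_pos[of "{v, q}" "{{v, q}}"] F assms(2) by simp
  qed
  obtain w where w: "w \<noteq> v" "{p, w} \<in> F" "\<not> orth {p, v} {p, w}"
    using not_orth_neighbour[of p v] F by (auto simp: insert_commute)
  then have "\<not> orth {p, w} {v, p}" using orth_commute F by (simp add: insert_commute)
  then have "\<not> orth {p, w} {v, q}" using par w by blast
  then have "{p, w} \<inter> {v, q} \<noteq> {}" using not_orth_meet w F by blast
  then have "w = q" using w assms(5) edge_distinct F by auto
  then show ?thesis using w by simp
qed

lemma d_avoiding_insert_less:
  assumes "e \<in> F" "e \<inter> T \<noteq> {}" "avoiding F T \<noteq> {}"
  obtains v where "d (avoiding F (insert v T)) < d (avoiding F T)"
proof (rule ccontr)
  assume "\<not> thesis"
  then have asm: "d (avoiding F T) \<le> d (avoiding F (insert v T))" for v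
    using linorder_not_less that by blast
  define P Q where "P = avoiding F T" and "Q = F - P"
  have P: "P \<subset> F" "Q \<subset> F" using assms unfolding P_def Q_def avoiding_def by auto
  have end_of: "\<exists>v. f \<subseteq> insert v T" if "f \<in> Q" for f
  proof -
    obtain s where "s \<in> f" "s \<in> T" using \<open>f \<in> Q\<close> by (auto simp: Q_def P_def avoiding_def)
    moreover obtain v where "f = {s, v}"
      using edge_other[of f s] \<open>f \<in> Q\<close> \<open>s \<in> f\<close> P by blast
    ultimately show ?thesis by blast
  qed
  \<comment> \<open>All of \<open>f\<close> lies in \<open>insert v T\<close>, so \<open>f\<close>
    is orthogonal to every edge that survives the addition of \<open>v\<close>. Non-orthogonality to
    \<open>g\<close> would force the dimension to drop.\<close>
  have orth: "orth f g" if "f \<in> Q" "g \<in> P" for f g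
  proof (rule ccontr)
    assume n: "\<not> orth f g"
    obtain v where v: "f \<subseteq> insert v T" using end_of \<open>f \<in> Q\<close> by blast
    have fF: "f \<in> F" "P \<subseteq> F" using that P by auto
    have "d (avoiding F (insert v T)) < d P"
      by (rule d_less[of _ _ g f])
        (use n fF v that in \<open>auto simp: P_def avoiding_def intro!: orth_disjoint\<close>)
    then show False using asm[of v] P_def by simp
  qed
  \<comment> \<open>Adding \<open>v\<close> keeps the full dimension of \<open>P\<close>, and what
    survives avoids \<open>f\<close> and is orthogonal to \<open>Q\<close>. Hence \<open>Q\<close>
    satisfies the local bound for \<open>k - d P\<close>, which leaves \<open>d P\<close> colours
    for \<open>P\<close>.\<close>
  have loc: "d (avoiding Q f) + d P < k" if f: "f \<in> Q" for f
  proof -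
    obtain v where v: "f \<subseteq> insert v T" using end_of f by blast
    have "d (avoiding Q f) + d (avoiding F (insert v T)) \<le> d (avoiding Q f \<union> avoiding F (insert v T))"
      using P orth by (intro d_orth) (auto simp: avoiding_def P_def)
    also have "\<dots> \<le> d (avoiding F f)"
      using v P by (intro d_mono) (auto simp: avoiding_def)
    finally show ?thesis using asm[of v] P_def local_dim[of f] f P by fastforce
  qed
  then have "colourable Q (k - d P)"
    using P by (intro minimal) (auto simp: less_diff_conv)
  moreover have "e \<in> Q" using assms by (auto simp: P_def Q_def avoiding_def)
  then have "d P \<le> k" using loc by fastforce
  ultimately have "colourable F k"
    using colourable_Un[OF _ colourable_d[OF P(1)], of Q "k - d P" F] by (simp add: Q_def)
  then show False using not_colourable by blast
qed

section \<open>Tight vertex sets\<close>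

definition tight :: "'a set \<Rightarrow> bool" where
  "tight T \<longleftrightarrow> finite T \<and> (\<exists>e\<in>F. e \<inter> T \<noteq> {}) \<and> d (avoiding F T) + card T \<le> k + 1"

text \<open>The reverse inequality is \<open>d_avoiding_lower\<close>; this is where a tight set has
  to meet an edge.\<close>

lemma tight_eq:
  assumes "tight T"
  shows "d (avoiding F T) + card T = k + 1"
proof -
  obtain e where "e \<in> F" "e \<inter> T \<noteq> {}" using assms unfolding tight_def by blast
  then have "k < d (avoiding F T) + card T"
    using assms d_avoiding_lower unfolding tight_def by blast
  then show ?thesis using assms unfolding tight_def by simp
qed

lemma tight_edge:
  assumes "e \<in> F"
  shows "tight e"
proof -
  have "card e = 2" using card_edge assms by blast
  then show ?thesis
    using local_dim[OF assms] edge_nonempty[OF assms] assms unfolding tight_def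
    by (auto intro: card_ge_0_finite)
qed

lemma tight_insert:
  assumes "tight T" "d (avoiding F (insert v T)) < d (avoiding F T)"
  shows "tight (insert v T)" "v \<notin> T"
proof -
  show v: "v \<notin> T" using assms(2) by (auto simp: insert_absorb)
  then show "tight (insert v T)"
    using assms unfolding tight_def by auto
qed

text \<open>Adding a hook of \<open>e\<close> to a tight superset of \<open>A\<close> that avoids \<open>e\<close> lowers the dimension, as the
  edge \<open>{a, x}\<close> becomes orthogonal to everything that remains.\<close>

definition hook :: "'a set \<Rightarrow> 'a \<Rightarrow> 'a set \<Rightarrow> bool" where
  "hook A a e \<longleftrightarrow> a \<in> e \<and> (\<exists>x\<in>A. {a, x} \<in> F \<and> \<not> orth {a, x} e)"

text \<open>The hooks are added one at a time. As \<open>M\<close> is a matching, the edge whose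
  hook comes next still avoids all earlier hooks, so each step lowers the dimension by its
  hook.\<close>

lemma tight_transversal:
  assumes "tight A" "M \<subseteq> avoiding F A" "pairwise disjnt M" "\<And>e. e \<in> M \<Longrightarrow> hook A (a e) e"
  shows "tight (A \<union> a ` M) \<and> card (A \<union> a ` M) = card A + card M"
proof -
  have "finite M" using assms(2) finite_F avoiding_subset finite_subset by metis
  then show ?thesis
    using assms(2-4)
  proof (induction M rule: finite_induct)
    case empty
    then show ?case using assms(1) by simp
  next
    case (insert e M)
    let ?T = "A \<union> a ` M"
    have IH: "tight ?T" "card ?T = card A + card M"
      using insert.IH insert.prems by (auto simp: pairwise_insert)
    obtain x where x: "x \<in> A" "{a e, x} \<in> F" "\<not> orth {a e, x} e"
      using insert.prems(3)[of e] unfolding hook_def by blast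
    have "e \<inter> f = {}" if "f \<in> M" for f
      using insert.prems(2) insert.hyps that by (auto simp: pairwise_insert disjnt_def)
    moreover have "a f \<in> f" if "f \<in> M" for f
      using insert.prems(3) that unfolding hook_def by blast
    ultimately have e: "e \<in> avoiding F ?T"
      using insert.prems(1) by (fastforce simp: avoiding_def)
    have "d (avoiding F (insert (a e) ?T)) < d (avoiding F ?T)"
      by (rule d_less[of _ _ e "{a e, x}"])
        (use x e in \<open>auto simp: avoiding_def intro!: orth_disjoint\<close>)
    then have "tight (insert (a e) ?T)" "a e \<notin> ?T" using tight_insert IH by blast+
    moreover have "finite ?T" using IH unfolding tight_def by blast
    ultimately show ?case using IH insert.hyps by simp
  qed
qed

text \<open>Counting makes \<open>A\<close> with the hooks a tight set of size \<open>k\<close>, so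
  the surviving edges span dimension 1. They all contain \<open>v\<close>, because every edge of
  \<open>M\<close> contains its own hook.\<close>

lemma transversal_pendant:
  assumes "tight A" "tight (insert v A)" "v \<notin> A"
    and M: "M = avoiding F (insert v A)" "pairwise disjnt M"
    and hooks: "\<And>e. e \<in> M \<Longrightarrow> hook A (a e) e"
  obtains p where "p \<notin> \<Union>M" "avoiding F (A \<union> a ` M) = {{v, p}}"
proof -
  have "finite A" using assms(1) unfolding tight_def by blast
  have MF: "M \<subseteq> F" "M \<subseteq> avoiding F A" using M by (auto simp: avoiding_def)
  have aM: "a e \<in> e" if "e \<in> M" for e using hooks that unfolding hook_def by blast
  have "d M = card M" using d_matching M MF by (auto simp: pairwise_def disjnt_def)
  then have cardM: "card A + card M = k"
    using tight_eq[OF assms(2)] \<open>finite A\<close> assms(3) M(1) by simp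
  define G where "G = avoiding F (A \<union> a ` M)"
  have GF: "G \<subseteq> F" unfolding G_def by (rule avoiding_subset)
  have "tight (A \<union> a ` M)" "card (A \<union> a ` M) = k"
    using tight_transversal[OF assms(1) MF(2) M(2), of a] hooks cardM by auto
  then have dG: "d G = 1" using tight_eq unfolding G_def by fastforce
  have notM: "g \<notin> M" if "g \<in> G" for g
    using aM[of g] that unfolding G_def avoiding_def by blast
  have vG: "v \<in> g" if "g \<in> G" for g
  proof (rule ccontr)
    assume "v \<notin> g"
    then have "g \<in> M" using that M(1) by (auto simp: G_def avoiding_def)
    then show False using notM that by blast
  qed
  have "G \<noteq> {}" using dG d_empty by auto
  then obtain g where "g \<in> G" by blast
  then obtain p where p: "{v, p} \<in> G" "v \<noteq> p"
    using edge_other[of g v] vG[of g] GF by blast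
  \<comment> \<open>Two parallel edges at \<open>v\<close> would give an edge \<open>{p, q}\<close>
    that avoids \<open>v\<close>, \<open>A\<close> and all hooks. It would belong to
    \<open>M\<close> without containing a hook.\<close>
  have uniq: "q = p" if q: "{v, q} \<in> G" for q
  proof (rule ccontr)
    assume "q \<noteq> p"
    then have "{p, q} \<in> F" using parallel_edges_adjacent[of G v p q] GF dG p q by auto
    moreover have "v \<noteq> q" using edge_distinct GF q by blast
    ultimately have "{p, q} \<in> M" "{p, q} \<in> G"
      using p q M(1) by (auto simp: G_def avoiding_def)
    then show False using notM by blast
  qed
  have "G = {{v, p}}"
  proof -
    have "g = {v, p}" if "g \<in> G" for g
      using edge_other[of g v] vG[of g] GF uniq that by blast
    then show ?thesis using p by blast
  qed
  \<comment> \<open>If \<open>p\<close> lay on \<open>e\<close> in \<open>M\<close>, dropping the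
    hook of \<open>e\<close> would leave \<open>k - 1\<close> vertices, and the surviving edges
    would be among \<open>e\<close>, \<open>{v, a e}\<close> and \<open>{v, p}\<close>. These
    intersect pairwise, so one further colour would do.\<close>
  moreover have "p \<notin> \<Union>M"
  proof
    assume "p \<in> \<Union>M"
    then obtain e where e: "e \<in> M" "p \<in> e" by blast
    let ?T = "A \<union> a ` (M - {e})"
    have "finite M" using MF finite_F finite_subset by blast
    have "card ?T = card A + card (M - {e})"
      using tight_transversal[OF assms(1), of "M - {e}" a] MF M(2) hooks
      by (auto intro: pairwise_subset)
    then have T: "1 + card ?T = k"
      using cardM \<open>finite M\<close> e by (metis add.left_commute card_Suc_Diff1 plus_1_eq_Suc)
    have "g = e \<or> g = {v, a e} \<or> g = {v, p}" if g: "g \<in> avoiding F ?T" for g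
    proof (cases "v \<in> g")
      case False
      then have "g \<in> M" using g M(1) by (auto simp: avoiding_def)
      then show ?thesis using aM[of g] g by (auto simp: avoiding_def)
    next
      case True
      then obtain q where q: "g = {v, q}" using edge_other[of g v] g in_avoiding by blast
      have "g \<in> G" if "q \<noteq> a e"
      proof -
        have "v \<noteq> a e" using aM[OF e(1)] e(1) M(1) by (auto simp: avoiding_def)
        then show ?thesis using g q that by (auto simp: G_def avoiding_def)
      qed
      then show ?thesis using q uniq by blast
    qed
    then have "colourable (avoiding F ?T) 1"
      using e(2) aM[OF e(1)] by (intro colourable_intersecting) blast
    moreover have "finite ?T" using \<open>finite A\<close> \<open>finite M\<close> by blast
    ultimately have "colourable F k" using colourable_if_avoiding T by metis
    then show False using not_colourable by blast
  qed
  ultimately show ?thesis using that G_def by blast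
qed

text \<open>Only one edge outside \<open>M\<close> can avoid \<open>A\<close>, namely the pendant
  edge \<open>{v, p}\<close>. Any other edge \<open>{v, q}\<close> would be hit by a hook
  \<open>q\<close>; exchanging this hook for the other end of its edge makes \<open>{v, q}\<close>
  the surviving edge, although \<open>q\<close> is covered by \<open>M\<close>.\<close>

lemma matching_extend:
  assumes "tight A" "tight (insert v A)" "v \<notin> A" "pairwise disjnt (avoiding F (insert v A))"
  shows "pairwise disjnt (avoiding F A)"
proof -
  define M where "M = avoiding F (insert v A)"
  have disj: "pairwise disjnt M" using assms(4) M_def by simp
  have MF: "e \<in> F" "v \<notin> e" "e \<inter> A = {}" if "e \<in> M" for e
    using that unfolding M_def avoiding_def by auto
  have same: "e = f" if "e \<in> M" "f \<in> M" "x \<in> e" "x \<in> f" for e f x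
    using disj that by (meson disjnt_iff pairwiseD)
  have outside: "y \<in> insert v A" if "{s, t} \<in> M" "{t, y} \<in> F" "y \<noteq> s" for s t y
  proof (rule ccontr)
    assume "y \<notin> insert v A"
    then have "{t, y} \<in> M" using that MF[OF that(1)] unfolding M_def avoiding_def by auto
    then have "{s, t} = {t, y}" using same[OF that(1), of "{t, y}" t] by simp
    then show False using that by (auto simp: doubleton_eq_iff)
  qed
  \<comment> \<open>The two neighbours from \<open>not_orth_path\<close> end in
    \<open>insert v A\<close>, since \<open>M\<close> is a matching. Their ends are distinct, so
    they are not both \<open>v\<close>, and one of them lies in \<open>A\<close>.\<close>
  have "\<exists>a. hook A a e" if "e \<in> M" for e
  proof -
    obtain s t where e: "e = {s, t}" using card_edge MF \<open>e \<in> M\<close> by (meson card_2_iff)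
    then have st: "{s, t} \<in> M" "{t, s} \<in> M" "{s, t} \<in> F" using that MF by (auto simp: insert_commute)
    obtain x y where xy: "x \<noteq> y" "x \<noteq> t" "y \<noteq> s" "{s, x} \<in> F" "{t, y} \<in> F"
      "\<not> orth {s, t} {s, x}" "\<not> orth {s, t} {t, y}"
      using not_orth_path[OF st(3)] by blast
    then have "x \<in> A \<or> y \<in> A" using outside st by blast
    moreover have "\<not> orth {s, x} {s, t}" "\<not> orth {t, y} {s, t}"
      using xy st(3) orth_commute[OF st(3)] by auto
    ultimately show ?thesis using xy(4,5) unfolding hook_def e by blast
  qed
  then obtain a where a: "\<And>e. e \<in> M \<Longrightarrow> hook A (a e) e" by metis
  note pendant = transversal_pendant[OF assms(1-3) M_def disj]
  obtain p where p: "p \<notin> \<Union>M" "avoiding F (A \<union> a ` M) = {{v, p}}"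
    using pendant[OF a] by blast
  have only: "q = p" if q: "{v, q} \<in> avoiding F A" for q
  proof (rule ccontr)
    assume "q \<noteq> p"
    then have "{v, q} \<notin> avoiding F (A \<union> a ` M)" using p by (auto simp: doubleton_eq_iff)
    moreover have va: "v \<notin> a ` M" using a MF unfolding hook_def by blast
    ultimately obtain e where e: "e \<in> M" "q = a e"
      using q by (auto simp: avoiding_def)
    then obtain b where b: "e = {q, b}" "q \<noteq> b"
      using edge_other[of e q] MF(1)[of e] a[of e] unfolding hook_def by blast
    then have qb: "{q, b} \<in> F" "{q, b} \<in> M" using MF e by auto
    obtain y where y: "y \<noteq> q" "{b, y} \<in> F" "\<not> orth {q, b} {b, y}"
      using not_orth_path[OF qb(1)] by blast
    have bM: "b \<notin> a ` M"
    proof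
      assume "b \<in> a ` M"
      then obtain f where f: "f \<in> M" "b = a f" by blast
      then have "b \<in> f" using a unfolding hook_def by blast
      then have "f = e" using same[OF f(1) e(1), of b] b by simp
      then show False using f(2) e(2) b(2) by simp
    qed
    \<comment> \<open>With \<open>y = v\<close> the edge \<open>{v, b}\<close> would survive the
      original hooks, so \<open>b\<close> would equal \<open>p\<close>, which \<open>M\<close> does
      not cover.\<close>
    have "y \<noteq> v"
    proof
      assume "y = v"
      then have "{v, b} \<in> avoiding F (A \<union> a ` M)"
        using y bM va q MF[OF e(1)] b by (auto simp: avoiding_def insert_commute)
      then have "b = p" using p by (auto simp: doubleton_eq_iff)
      then show False using p b e by blast
    qed
    then have "y \<in> A" using outside qb y by blast
    moreover have "\<not> orth {b, y} {q, b}" using y orth_commute[OF qb(1)] by auto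
    ultimately have "hook A b e" using y(2) unfolding hook_def b(1) by blast
    then have a': "hook A ((a(e := b)) f) f" if "f \<in> M" for f
      using a that by simp
    obtain p' where p': "p' \<notin> \<Union>M" "avoiding F (A \<union> a(e := b) ` M) = {{v, p'}}"
      using pendant[OF a'] by blast
    have "q \<notin> a(e := b) ` M"
    proof
      assume "q \<in> a(e := b) ` M"
      then obtain f where f: "f \<in> M" "q = (a(e := b)) f" by blast
      have "f \<noteq> e" using f(2) b(2) by auto
      moreover have "q \<in> f" using a'[OF f(1)] unfolding hook_def f(2)[symmetric] by blast
      ultimately show False using same[OF f(1) e(1), of q] b(1) by simp
    qed
    moreover have "v \<notin> a(e := b) ` M" using a' MF unfolding hook_def by blast
    ultimately have "{v, q} \<in> avoiding F (A \<union> a(e := b) ` M)"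
      using q by (auto simp: avoiding_def)
    then have "q = p'" using p' by (auto simp: doubleton_eq_iff)
    then show False using p' e b by blast
  qed
  have "e \<in> M \<or> e = {v, p}" if e: "e \<in> avoiding F A" for e
  proof (cases "v \<in> e")
    case True
    then show ?thesis using edge_other[of e v] only e in_avoiding by blast
  next
    case False
    then show ?thesis using e by (auto simp: M_def avoiding_def)
  qed
  moreover have "e \<inter> {v, p} = {}" if "e \<in> M" for e
    using that MF p by blast
  moreover have "pairwise disjnt (insert {v, p} M)"
    using disj calculation(2) by (auto simp: pairwise_insert disjnt_def)
  ultimately show ?thesis by (auto intro: pairwise_subset)
qed

text \<open>The induction starts at vertex covers, where no edge is left. Otherwise some added
  vertex lowers the dimension and \<open>matching_extend\<close> transfers the property
  back.\<close>

lemma tight_matching: "tight T \<Longrightarrow> pairwise disjnt (avoiding F T)"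
proof (induction "d (avoiding F T)" arbitrary: T rule: less_induct)
  case less
  show ?case
  proof (cases "avoiding F T = {}")
    case False
    obtain e where "e \<in> F" "e \<inter> T \<noteq> {}" using less.prems unfolding tight_def by blast
    then obtain v where v: "d (avoiding F (insert v T)) < d (avoiding F T)"
      using d_avoiding_insert_less False by blast
    then show ?thesis
      using matching_extend less tight_insert[OF less.prems v] by blast
  qed simp
qed

section \<open>The four-cycle and the final contradiction\<close>

lemma no_linked_edges:
  assumes "{x, y} \<in> F" "{s, t} \<in> avoiding F {x, y}" "{s, x} \<in> F" "{t, y} \<in> F"
  shows False
proof -
  let ?M = "avoiding F {x, y}"
  have dist: "s \<noteq> x" "s \<noteq> y" "t \<noteq> x" "t \<noteq> y" "s \<noteq> t" "x \<noteq> y"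
    using assms edge_distinct by (auto simp: avoiding_def)
  have match: "f = g" if "e \<in> F" "f \<in> avoiding F e" "g \<in> avoiding F e" "f \<inter> g \<noteq> {}" for e f g
    using tight_matching[OF tight_edge[OF that(1)]] that(2-) by (meson disjnt_def pairwiseD)
  \<comment> \<open>An edge leaving the four vertices at \<open>y\<close> would share
    \<open>y\<close> with \<open>{t, y}\<close> while both avoid \<open>{s, x}\<close>, against the
    matching property. At \<open>x\<close> the two opposite edges of the four-cycle exchange
    roles.\<close>
  have y: "f \<subseteq> {x, y, s, t}" if f: "f \<in> F" "y \<in> f" for f
  proof (rule ccontr)
    assume n: "\<not> ?thesis"
    obtain q where q: "f = {y, q}" using edge_other[of f y] f by blast
    have "f = {t, y}"
      using assms f dist n q by (intro match[OF assms(3)]) (auto simp: avoiding_def)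
    then show False using n by blast
  qed
  have x: "f \<subseteq> {x, y, s, t}" if f: "f \<in> F" "x \<in> f" for f
  proof (rule ccontr)
    assume n: "\<not> ?thesis"
    obtain q where q: "f = {x, q}" using edge_other[of f x] f by blast
    have "f = {s, x}"
      using assms f dist n q by (intro match[OF assms(4)]) (auto simp: avoiding_def)
    then show False using n by blast
  qed
  have "{x, y} \<notin> ?M" by (simp add: avoiding_def)
  then have MF: "?M - {{s, t}} \<subset> F" using assms(1) avoiding_subset[of F "{x, y}"] by blast
  have fin: "finite ?M" using finite_F by (simp add: avoiding_def)
  have "d ?M = card ?M"
    using match[OF assms(1)] by (intro d_matching[OF avoiding_subset]) blast
  then have cardM: "card ?M + 1 = k"
    using tight_eq[OF tight_edge[OF assms(1)]] dist by simp
  then have "d (?M - {{s, t}}) + 2 \<le> k"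
    using d_le_card[OF psubset_imp_subset[OF MF]] card_Suc_Diff1[OF fin assms(2)] by simp
  then have c1: "colourable (?M - {{s, t}}) (k - 2)" "2 \<le> k"
    using colourable_mono[OF colourable_d[OF MF]] by auto
  have c2: "colourable {f \<in> F. s \<in> f} 1"
    by (rule colourable_intersecting) blast
  have c3: "colourable {f \<in> F. f \<subseteq> {x, y, t}} 1"
  proof (rule colourable_intersecting)
    fix f g assume "f \<in> {f \<in> F. f \<subseteq> {x, y, t}}" "g \<in> {f \<in> F. f \<subseteq> {x, y, t}}"
    moreover from this have "card f = 2" "card g = 2" using card_edge by auto
    then obtain p q p' q' where "f = {p, q}" "p \<noteq> q" "g = {p', q'}" "p' \<noteq> q'"
      by (meson card_2_iff)
    ultimately show "f \<inter> g \<noteq> {}" by auto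
  qed
  \<comment> \<open>The colours are those of the \<open>k - 2\<close> other matching edges, one for
    the star of \<open>s\<close> and one for the triangle on \<open>x\<close>, \<open>y\<close>,
    \<open>t\<close>.\<close>
  have "f \<in> ?M - {{s, t}} \<or> s \<in> f \<or> f \<subseteq> {x, y, t}" if "f \<in> F" for f
    using x[OF that] y[OF that] that by (auto simp: avoiding_def)
  then have "colourable F (k - 2 + (1 + 1))"
    by (intro colourable_Un[OF c1(1) colourable_Un[OF c2 c3 order_refl]]) blast
  moreover have "k - 2 + (1 + 1) = k" using c1(2) by simp
  ultimately show False using not_colourable by metis
qed

lemma contradiction: False
proof -
  obtain e where "e \<in> F" using nonempty by blast
  then obtain x y where xy: "{x, y} \<in> F" "x \<noteq> y" using card_edge[of e] by (auto simp: card_2_iff)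
  let ?M = "avoiding F {x, y}"
  show False
  proof (cases "?M = {}")
    case True
    then have k: "k = 1" using tight_eq[OF tight_edge[OF xy(1)]] xy(2) d_empty by simp
    \<comment> \<open>For \<open>k = 1\<close> the bound of \<open>d_avoiding_path\<close> is
      impossible, so no two distinct edges meet and \<open>F\<close> is a single edge.\<close>
    have path: False if "{a, b} \<in> F" "{b, c} \<in> F" "a \<noteq> c" for a b c
      using d_avoiding_path[OF that] k by simp
    have "f = {x, y}" if f: "f \<in> F" for f
    proof -
      have "x \<in> f \<or> y \<in> f" using True f by (auto simp: avoiding_def)
      then obtain w where "f = {x, w} \<or> f = {y, w}" using edge_other[of f x] edge_other[of f y] f by blast
      then show ?thesis using path[of y x w] path[of x y w] xy f by (auto simp: insert_commute)
    qed
    then have "colourable F 1" by (intro colourable_intersecting) blast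
    then show False using not_colourable k by simp
  next
    case False
    then obtain e where e: "e \<in> ?M" by blast
    then obtain s t where st: "e = {s, t}" using card_edge by (metis card_2_iff in_avoiding)
    have in_xy: "z \<in> {x, y}" if "{a, b} \<in> ?M" "{a, z} \<in> F" "z \<noteq> b" for a b z
    proof (rule ccontr)
      assume "z \<notin> {x, y}"
      then have "{a, z} \<in> ?M" using that by (auto simp: avoiding_def)
      moreover have "{a, z} \<noteq> {a, b}" using that by (auto simp: doubleton_eq_iff)
      ultimately show False
        using pairwiseD[OF tight_matching[OF tight_edge[OF xy(1)]] _ that(1)] by (auto simp: disjnt_def)
    qed
    have M: "{s, t} \<in> ?M" "{t, s} \<in> ?M" "{s, t} \<in> F" using e st by (auto simp: avoiding_def insert_commute)
    obtain z w where zw: "z \<noteq> w" "z \<noteq> t" "w \<noteq> s" "{s, z} \<in> F" "{t, w} \<in> F"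
      using not_orth_path[OF M(3)] by blast
    then have "z \<in> {x, y}" "w \<in> {x, y}" using in_xy M by blast+
    then consider "z = x" "w = y" | "z = y" "w = x" using zw by auto
    then show False
      by cases (use no_linked_edges[of x y s t] no_linked_edges[of y x s t] xy M zw in
        \<open>auto simp: insert_commute\<close>)
  qed
qed

end

section \<open>Induction over subfamilies\<close>

lemma orth_rank_subset:
  assumes "orth_rank F d orth" "G \<subseteq> F"
  shows "orth_rank G d orth"
proof -
  interpret orth_rank F d orth by fact
  show ?thesis
  proof
    show "finite G" using finite_F assms(2) finite_subset by blast
    show "d (X \<union> Y) \<le> d Z" if "Z \<subseteq> X" "X \<subseteq> G" "Z \<subseteq> Y" "Y \<subseteq> G" "d X \<le> d Z" "d Y \<le> d Z" for X Y Z
      using d_closure[of Z X Y] that assms(2) by blast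
    show "d X + d Y \<le> d (X \<union> Y)" if "X \<subseteq> G" "Y \<subseteq> G" "\<And>x y. x \<in> X \<Longrightarrow> y \<in> Y \<Longrightarrow> orth x y" for X Y
      using d_orth[of X Y] that assms(2) by blast
    show "d Y < d X" if "Y \<subseteq> X" "X \<subseteq> G" "x \<in> X" "e \<in> G" "\<not> orth e x" "\<And>y. y \<in> Y \<Longrightarrow> orth e y" for X Y x e
      using d_less[of Y X x e] that assms(2) by blast
    show "d X \<le> d Y" if "X \<subseteq> Y" "Y \<subseteq> G" for X Y
      using d_mono[of X Y] that assms(2) by blast
    show "d X \<le> card X" if "X \<subseteq> G" for X
      using d_le_card[of X] that assms(2) by blast
    show "orth e f \<longleftrightarrow> orth f e" if "e \<in> G" "f \<in> G" for e f
      using orth_commute[of e f] that assms(2) by auto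
    show "orth e f" if "e \<in> G" "f \<in> G" "e \<inter> f = {}" for e f
      using orth_disjoint[of e f] that assms(2) by blast
  qed (use assms(2) card_edge not_orth_self in auto)
qed

theorem orth_rank_colourable:
  assumes "orth_rank F d orth" "\<And>e. e \<in> F \<Longrightarrow> d (avoiding F e) < k"
  shows "colourable F k"
proof -
  have "finite F" using assms(1) by (rule orth_rank.finite_F)
  then show ?thesis
    using assms
  proof (induction F arbitrary: k rule: finite_psubset_induct)
    case (psubset F)
    show ?case
    proof (rule ccontr)
      assume n: "\<not> colourable F k"
      have "minimal_counterexample F d orth k"
        unfolding minimal_counterexample_def minimal_counterexample_axioms_def
        using psubset n orth_rank_subset by (meson psubset_imp_subset)
      then show False by (rule minimal_counterexample.contradiction)
    qed
  qed
qed

section \<open>Orthogonal representations\<close>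

text \<open>Equal dimension means equal span for nested sets, which gives the closure property. A
  vector orthogonal to a set is orthogonal to its span, which gives the strict increase.\<close>

lemma orth_rank_orth_rep:
  assumes "finite F" "\<And>e. e \<in> F \<Longrightarrow> card e = 2" "orth_rep F (K_adj F) t u"
  shows "orth_rank F (\<lambda>X. vdim (u ` X)) (\<lambda>e f. ip t (u e) (u f) = 0)"
proof
  have fin: "finite (u ` X)" if "X \<subseteq> F" for X
    using that assms(1) finite_subset by blast
  have u: "\<And>e i. e \<in> F \<Longrightarrow> i \<ge> t \<Longrightarrow> u e i = 0"
    "\<And>e. e \<in> F \<Longrightarrow> ip t (u e) (u e) \<noteq> 0"
    "\<And>e f. K_adj F e f \<Longrightarrow> ip t (u e) (u f) = 0"
    using assms(3) unfolding orth_rep_def K_adj_def by auto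
  show "vdim (u ` X) \<le> vdim (u ` Y)" if "X \<subseteq> Y" "Y \<subseteq> F" for X Y
    unfolding vdim_def
    by (rule rvec.dim_mono_finite[OF fin[OF that(2)] order_trans[OF image_mono[OF that(1)] rvec.span_superset]])
  show "vdim (u ` X) \<le> card X" if "X \<subseteq> F" for X
    using rvec.dim_le_card'[OF fin[OF that]] card_image_le[of X u] that assms(1) finite_subset
    unfolding vdim_def by fastforce
  show "vdim (u ` (X \<union> Y)) \<le> vdim (u ` Z)"
    if "Z \<subseteq> X" "X \<subseteq> F" "Z \<subseteq> Y" "Y \<subseteq> F" "vdim (u ` X) \<le> vdim (u ` Z)" "vdim (u ` Y) \<le> vdim (u ` Z)"
    for X Y Z
  proof -
    have "u ` X \<subseteq> rvec.span (u ` Z)" "u ` Y \<subseteq> rvec.span (u ` Z)"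
      using that fin unfolding vdim_def by (simp_all add: rvec.subset_span_if_dim_le image_mono)
    moreover have "finite (u ` Z)" using that fin by blast
    ultimately show ?thesis
      unfolding vdim_def image_Un by (intro rvec.dim_mono_finite) simp_all
  qed
  show "vdim (u ` X) + vdim (u ` Y) \<le> vdim (u ` (X \<union> Y))"
    if "X \<subseteq> F" "Y \<subseteq> F" "\<And>x y. x \<in> X \<Longrightarrow> y \<in> Y \<Longrightarrow> ip t (u x) (u y) = 0" for X Y
  proof -
    have "rvec.span (u ` X) \<inter> rvec.span (u ` Y) \<subseteq> {0}"
      by (rule orthogonal_spans_disjoint[of _ t]) (use that u(1) in blast)+
    then show ?thesis
      unfolding vdim_def image_Un using fin that(1,2) by (simp add: rvec.dim_Un_if_spans_disjoint)
  qed
  show "vdim (u ` Y) < vdim (u ` X)"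
    if "Y \<subseteq> X" "X \<subseteq> F" "x \<in> X" "e \<in> F" "ip t (u e) (u x) \<noteq> 0" "\<And>y. y \<in> Y \<Longrightarrow> ip t (u e) (u y) = 0"
    for X Y x e
  proof (rule ccontr)
    assume "\<not> ?thesis"
    then have "u ` X \<subseteq> rvec.span (u ` Y)"
      using that(1) fin[OF that(2)] unfolding vdim_def
      by (simp add: rvec.subset_span_if_dim_le image_mono)
    then show False using ip_span_eq_0[of "u ` Y" t "u e" "u x"] that by blast
  qed
  show "ip t (u e) (u f) = 0" if "e \<in> F" "f \<in> F" "e \<inter> f = {}" for e f
    using that assms(2)[of e] by (intro u(3)) (auto simp: K_adj_def)
  show "ip t (u e) (u f) = 0 \<longleftrightarrow> ip t (u f) (u e) = 0" for e f
    by (simp only: ip_commute[of t "u e"])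
qed (use assms in \<open>auto simp: orth_rep_def\<close>)

text \<open>The vector of \<open>e\<close> is orthogonal to those of its neighbours and adds one
  dimension to them, so the neighbours alone span strictly less than the locality.\<close>

lemma colourable_locality:
  assumes "finite F" "\<And>e. e \<in> F \<Longrightarrow> card e = 2" "orth_rep F (K_adj F) t u"
  shows "colourable F (locality F (K_adj F) u)"
proof -
  interpret orth_rank F "\<lambda>X. vdim (u ` X)" "\<lambda>e f. ip t (u e) (u f) = 0"
    by (rule orth_rank_orth_rep[OF assms])
  show ?thesis
  proof (rule orth_rank_colourable[OF orth_rank_axioms])
    fix e assume e: "e \<in> F"
    have "nbhd F (K_adj F) e = avoiding F e"
      using e edge_nonempty by (auto simp: nbhd_def K_adj_def avoiding_def)
    moreover have "vdim (u ` avoiding F e) + 1 \<le> vdim (u ` insert e (avoiding F e))"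
      using e by (intro d_insert_orth) (auto simp: avoiding_def intro!: orth_disjoint)
    ultimately have "vdim (u ` avoiding F e) + 1 \<le> vdim (u ` ({e} \<union> nbhd F (K_adj F) e))"
      by simp
    also have "\<dots> \<le> locality F (K_adj F) u"
      unfolding locality_def using e assms(1) by (intro Max_ge) auto
    finally show "vdim (u ` avoiding F e) < locality F (K_adj F) u" by simp
  qed
qed

text \<open>Each edge receives the standard basis vector of its colour; disjoint edges have
  different colours, and only \<open>k\<close> basis vectors occur.\<close>

lemma orth_rep_if_colourable:
  assumes "finite F" "colourable F k"
  obtains t u where "orth_rep F (K_adj F) t u" "locality F (K_adj F) u \<le> k"
proof -
  obtain c where c: "\<forall>e\<in>F. c e < k" "\<forall>e\<in>F. \<forall>f\<in>F. e \<inter> f = {} \<longrightarrow> e \<noteq> f \<longrightarrow> c e \<noteq> c f"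
    using assms(2) unfolding colourable_def by blast
  define b :: "nat \<Rightarrow> nat \<Rightarrow> real" where "b i = (\<lambda>j. if j = i then 1 else 0)" for i
  have ip: "ip k (b i) (b j) = (if i = j then 1 else 0)" if "i < k" for i j
  proof -
    have "ip k (b i) (b j) = (\<Sum>l<k. if l = i then (if i = j then 1 else 0) else 0)"
      unfolding ip_def b_def by (rule sum.cong) auto
    then show ?thesis using that by simp
  qed
  have "orth_rep F (K_adj F) k (\<lambda>e. b (c e))"
    unfolding orth_rep_def K_adj_def using c ip by (auto simp: b_def)
  moreover have "locality F (K_adj F) (\<lambda>e. b (c e)) \<le> k"
  proof -
    have dim: "vdim ((\<lambda>e. b (c e)) ` X) \<le> k" if "X \<subseteq> F" for X
    proof -
      have "(\<lambda>e. b (c e)) ` X \<subseteq> b ` {..<k}" using c that by auto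
      then have "vdim ((\<lambda>e. b (c e)) ` X) \<le> card (b ` {..<k})"
        unfolding vdim_def using rvec.span_superset[of "b ` {..<k}"]
        by (intro rvec.dim_le_card) (blast, simp)
      also have "\<dots> \<le> k" using card_image_le[of "{..<k}" b] by simp
      finally show ?thesis .
    qed
    have "vdim ((\<lambda>e. b (c e)) ` ({v} \<union> nbhd F (K_adj F) v)) \<le> k" if "v \<in> F" for v
      by (rule dim) (use that in \<open>auto simp: nbhd_def\<close>)
    then show ?thesis
      unfolding locality_def using assms(1) by (intro Max.boundedI) auto
  qed
  ultimately show ?thesis using that by blast
qed

theorem mainTheorem2:
  fixes n :: nat and F :: "nat set set"
  assumes "\<forall>A\<in>F. A \<subseteq> {1..n} \<and> card A = 2"
  shows "xi_l_real F (K_adj F) = chromatic_number F (K_adj F)"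
proof -
  have "F \<subseteq> Pow {1..n}" using assms by auto
  then have fin: "finite F" using finite_subset by blast
  have card2: "card e = 2" if "e \<in> F" for e using assms that by blast
  have chi: "chromatic_number F (K_adj F) = (LEAST k. colourable F k)"
    unfolding chromatic_number_def colourable_def K_adj_def
    by (rule arg_cong[of _ _ Least]) (rule ext, auto intro!: ex_cong)
  \<comment> \<open>The whole ground set is a vertex cover, so \<open>n\<close> colours suffice and
    the least number of colours is attained.\<close>
  have "avoiding F {1..n} = {}"
    using assms unfolding avoiding_def by (auto simp: Int_absorb2)
  then have "colourable F (0 + card {1..n})"
    by (intro colourable_if_avoiding) (simp_all add: colourable_empty)
  then have col: "colourable F (LEAST k. colourable F k)" by (rule LeastI)
  obtain t u where tu: "orth_rep F (K_adj F) t u"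
    "locality F (K_adj F) u \<le> (LEAST k. colourable F k)"
    using orth_rep_if_colourable[OF fin col] by blast
  have "xi_l_real F (K_adj F) \<le> locality F (K_adj F) u"
    unfolding xi_l_real_def using tu(1) by (intro Least_le) blast
  moreover have "\<exists>t u. orth_rep F (K_adj F) t u \<and> locality F (K_adj F) u = xi_l_real F (K_adj F)"
    unfolding xi_l_real_def by (rule LeastI[of _ "locality F (K_adj F) u"]) (use tu(1) in blast)
  then have "colourable F (xi_l_real F (K_adj F))"
    using colourable_locality[OF fin card2] by metis
  then have "(LEAST k. colourable F k) \<le> xi_l_real F (K_adj F)"
    by (rule Least_le)
  ultimately show ?thesis using tu(2) chi by simp
qed

end
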